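(* For any $\varepsilon>0$ there is a positive integer $p(\varepsilon)$ such that for all even $p\ge p(\varepsilon)$ $$\mathcal{M}^{\mathrm{EM}}_p(\mathcal{S}_p)<\frac{(3.539+\varepsilon)^p}{\pi\sqrt{p-1}}.$$
   Context: Explicit midpoint (EM) extrapolation of even order $p\ge2$, $r=p/2$, on the test equation $U'=\lambda U$, with $z=\tau\lambda\in\mathbb{C}$ and internal perturbations: given $U_n$ and residuals $\tilde r_{m,j}\in\mathbb{C}$ ($1\le m\le r$, $1\le j\le2m$), set $$\widetilde Y_{m,0}=U_n,\quad \widetilde Y_{m,1}=\Big(1+\frac z{2m}\Big)\widetilde Y_{m,0}+\tilde r_{m,1},\quad \widetilde Y_{m,j}=\widetilde Y_{m,j-2}+\frac zm\widetilde Y_{m,j-1}+\tilde r_{m,j}\ (2\le j\le2m),\quad T_{m,1}=\widetilde Y_{m,2m},$$ $$T_{j,k}=T_{j,k-1}+\frac{T_{j,k-1}-T_{j-1,k-1}}{\frac{j^2}{(j-k+1)^2}-1}\quad(2\le k\le j\le r),\qquad U_{n+1}=T_{r,r}.$$ Then $U_{n+1}=P(z)U_n+\sum_{m=1}^r\sum_{\ell=1}^{2m}Q^{\mathrm{EM}}_{p,m,\ell}(z)\,\tilde r_{m,\ell}$, which defines the internal stability polynomials $Q^{\mathrm{EM}}_{p,m,\ell}$. For $\mathcal{S}\subset\mathbb{C}$, $$\mathcal{M}^{\mathrm{EM}}_p(\mathcal{S}):=\max_{1\le m\le r}\max_{1\le\ell\le2m}\sup_{z\in\mathcal{S}}|Q^{\mathrm{EM}}_{p,m,\ell}(z)|.$$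 The absolute stability region of the method is $\mathcal{S}_p=\{z\in\mathbb{C}:|\sum_{k=0}^pz^k/k!|\le1\}$. *)

theory Defs
  imports "HOL-Analysis.Analysis" "HOL-Computational_Algebra.Polynomial"
begin

text \<open>
  One step of explicit midpoint extrapolation on $U' = \lambda U$ with $z = \tau\lambda$, started
  at \<open>u\<close> and with internal residuals \<open>r m j\<close>. All indices are those of the mathematical text
  (\<open>1 \<le> m\<close>, \<open>1 \<le> j \<le> 2m\<close>).
\<close>

fun em_Y :: "complex \<Rightarrow> complex \<Rightarrow> (nat \<Rightarrow> nat \<Rightarrow> complex) \<Rightarrow> nat \<Rightarrow> nat \<Rightarrow> complex" where
  "em_Y z u r m 0 = u"
| "em_Y z u r m (Suc 0) = (1 + z / (2 * of_nat m)) * em_Y z u r m 0 + r m 1"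
| "em_Y z u r m (Suc (Suc j)) =
     em_Y z u r m j + z / of_nat m * em_Y z u r m (Suc j) + r m (Suc (Suc j))"

text \<open>
  The extrapolation tableau $T_{j,k}$ for \<open>1 \<le> k \<le> j\<close>; the column \<open>k = 0\<close> is a dummy. In the last
  equation the column is $k + 2$, so that $j - (k + 2) + 1 = j - (k + 1)$ is the base of the
  squared denominator.
\<close>

fun em_T :: "complex \<Rightarrow> complex \<Rightarrow> (nat \<Rightarrow> nat \<Rightarrow> complex) \<Rightarrow> nat \<Rightarrow> nat \<Rightarrow> complex" where
  "em_T z u r j 0 = 0"
| "em_T z u r j (Suc 0) = em_Y z u r j (2 * j)"
| "em_T z u r j (Suc (Suc k)) = em_T z u r j (Suc k) +
     (em_T z u r j (Suc k) - em_T z u r (j - 1) (Suc k)) /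
       ((of_nat j)\<^sup>2 / (of_nat j - of_nat (k + 1))\<^sup>2 - 1)"

definition em_step :: "nat \<Rightarrow> complex \<Rightarrow> complex \<Rightarrow> (nat \<Rightarrow> nat \<Rightarrow> complex) \<Rightarrow> complex" where
  "em_step p z u r = em_T z u r (p div 2) (p div 2)"

text \<open>
  The step is affine in \<open>u\<close> and in the residuals; the coefficient of a residual is read off as the
  response to a unit residual. The lemmas \<open>em_step_decomposition\<close> and
  \<open>em_step_decomposition_unique\<close> below show that these are exactly the coefficients
  defined by the expansion of the step.
\<close>

definition em_P :: "nat \<Rightarrow> complex \<Rightarrow> complex" where
  "em_P p z = em_step p z 1 (\<lambda>_ _. 0)"

definition em_Q :: "nat \<Rightarrow> nat \<Rightarrow> nat \<Rightarrow> complex \<Rightarrow> complex" where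
  "em_Q p m l z = em_step p z 0 (\<lambda>m' l'. if m' = m \<and> l' = l then 1 else 0)"

text \<open>Extended real valued, since the supremum is infinite for some unbounded sets.\<close>

definition em_M :: "nat \<Rightarrow> complex set \<Rightarrow> ereal" where
  "em_M p S = (MAX m\<in>{1..p div 2}. MAX l\<in>{1..2 * m}. SUP z\<in>S. ereal (cmod (em_Q p m l z)))"

definition stab_region :: "nat \<Rightarrow> complex set" where
  "stab_region p = {z. cmod (\<Sum>k\<le>p. z ^ k / fact k) \<le> 1}"

lemma em_Y_linear:
  assumes "finite I"
  shows "em_Y z u (\<lambda>a b. \<Sum>i\<in>I. c i * f i a b) m j =
    em_Y z 1 (\<lambda>_ _. 0) m j * u + (\<Sum>i\<in>I. em_Y z 0 (f i) m j * c i)"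
proof (induction z u "\<lambda>a b. \<Sum>i\<in>I. c i * f i a b" m j rule: em_Y.induct)
  case (3 z u m j)
  then show ?case
    by (simp add: algebra_simps sum.distrib sum_distrib_left)
qed (simp_all add: algebra_simps)

lemma em_T_linear:
  assumes "finite I"
  shows "em_T z u (\<lambda>a b. \<Sum>i\<in>I. c i * f i a b) j k =
    em_T z 1 (\<lambda>_ _. 0) j k * u + (\<Sum>i\<in>I. em_T z 0 (f i) j k * c i)"
proof (induction k arbitrary: j rule: induct_nat_012)
  case 1
  then show ?case using em_Y_linear[OF assms] by simp
next
  case (ge2 k)
  define d :: complex where "d = (of_nat j)\<^sup>2 / (of_nat j - of_nat (k + 1))\<^sup>2 - 1"
  have step: "em_T z v s j (Suc (Suc k)) = em_T z v s j (Suc k) +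
    inverse d * (em_T z v s j (Suc k) - em_T z v s (j - 1) (Suc k))" for v s
    by (simp add: d_def divide_inverse mult.commute)
  show ?case
    unfolding step ge2.IH(2)
    by (simp add: algebra_simps sum.distrib sum_distrib_left sum_subtractf)
qed simp

lemma em_Y_cong:
  assumes "\<And>l. 1 \<le> l \<Longrightarrow> l \<le> j \<Longrightarrow> r m l = s m l"
  shows "em_Y z u r m j = em_Y z u s m j"
  using assms by (induction j rule: induct_nat_012) simp_all

lemma em_T_cong:
  assumes "\<And>m l. 1 \<le> m \<Longrightarrow> m \<le> j \<Longrightarrow> 1 \<le> l \<Longrightarrow> l \<le> 2 * m \<Longrightarrow> r m l = s m l" "k \<le> j"
  shows "em_T z u r j k = em_T z u s j k"
  using assms
proof (induction k arbitrary: j rule: induct_nat_012)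
  case 1
  then show ?case by (auto intro!: em_Y_cong)
next
  case (ge2 k)
  have "em_T z u r j (Suc k) = em_T z u s j (Suc k)"
    "em_T z u r (j - 1) (Suc k) = em_T z u s (j - 1) (Suc k)"
    by (rule ge2.IH(2); use ge2.prems in auto)+
  then show ?case by simp
qed simp

theorem em_step_decomposition:
  "em_step p z u r =
    em_P p z * u + (\<Sum>m=1..p div 2. \<Sum>l=1..2 * m. em_Q p m l z * r m l)"
proof -
  define I where "I = (SIGMA m:{1..p div 2}. {1..2 * m})"
  define e :: "nat \<times> nat \<Rightarrow> nat \<Rightarrow> nat \<Rightarrow> complex"
    where "e i = (\<lambda>a b. if a = fst i \<and> b = snd i then 1 else 0)" for i
  have fin: "finite I" by (simp add: I_def)
  have "r a b = (\<Sum>i\<in>I. r (fst i) (snd i) * e i a b)" if "(a, b) \<in> I" for a b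
  proof -
    have "(\<Sum>i\<in>I. r (fst i) (snd i) * e i a b) = (\<Sum>i\<in>I. if (a, b) = i then r a b else 0)"
      by (rule sum.cong) (auto simp: e_def)
    then show ?thesis using that fin by simp
  qed
  then have "em_step p z u r = em_step p z u (\<lambda>a b. \<Sum>i\<in>I. r (fst i) (snd i) * e i a b)"
    unfolding em_step_def by (intro em_T_cong) (auto simp: I_def)
  also have "\<dots> = em_P p z * u + (\<Sum>i\<in>I. em_Q p (fst i) (snd i) z * r (fst i) (snd i))"
    unfolding em_step_def em_T_linear[OF fin] by (simp add: em_P_def em_Q_def em_step_def e_def)
  also have "(\<Sum>i\<in>I. em_Q p (fst i) (snd i) z * r (fst i) (snd i)) =
    (\<Sum>m=1..p div 2. \<Sum>l=1..2 * m. em_Q p m l z * r m l)"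
    unfolding I_def by (subst sum.Sigma) (auto simp: case_prod_beta)
  finally show ?thesis .
qed

theorem em_step_decomposition_unique:
  assumes "\<And>u r. em_step p z u r =
    P * u + (\<Sum>m=1..p div 2. \<Sum>l=1..2 * m. Q m l * r m l)"
  shows "P = em_P p z"
    and "\<And>m l. m \<in> {1..p div 2} \<Longrightarrow> l \<in> {1..2 * m} \<Longrightarrow> Q m l = em_Q p m l z"
proof -
  show "P = em_P p z" by (simp add: em_P_def assms)
next
  fix m l assume ml: "m \<in> {1..p div 2}" "l \<in> {1..2 * m}"
  have "em_Q p m l z = (\<Sum>m'=1..p div 2. \<Sum>l'=1..2 * m'.
      Q m' l' * (if m' = m \<and> l' = l then 1 else 0))"
    by (simp add: em_Q_def assms)
  also have "\<dots> = (\<Sum>m'=1..p div 2. if m' = m then Q m l else 0)"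
  proof (rule sum.cong, rule refl)
    fix m'
    show "(\<Sum>l'=1..2 * m'. Q m' l' * (if m' = m \<and> l' = l then 1 else 0)) =
      (if m' = m then Q m l else 0)"
      using ml(2) by (cases "m' = m") (simp_all add: if_distrib cong: if_cong)
  qed
  also have "\<dots> = Q m l" using ml(1) by simp
  finally show "Q m l = em_Q p m l z" by simp
qed

lemma em_Y_poly: "\<exists>q. \<forall>z. em_Y z u r m j = poly q z"
proof (induction j rule: induct_nat_012)
  case 0
  show ?case by (rule exI[of _ "[:u:]"]) simp
next
  case 1
  show ?case
    by (rule exI[of _ "[:u + r m 1, u / (2 * of_nat m):]"]) (simp add: algebra_simps)
next
  case (ge2 j)
  then obtain q1 q2 where "\<forall>z. em_Y z u r m j = poly q1 z" "\<forall>z. em_Y z u r m (Suc j) = poly q2 z"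
    by blast
  then show ?case
    by (intro exI[of _ "q1 + [:0, 1 / of_nat m:] * q2 + [:r m (Suc (Suc j)):]"]) simp
qed

lemma em_T_poly: "\<exists>q. \<forall>z. em_T z u r j k = poly q z"
proof (induction k arbitrary: j rule: induct_nat_012)
  case 0
  show ?case by (rule exI[of _ 0]) simp
next
  case 1
  show ?case using em_Y_poly by simp
next
  case (ge2 k)
  obtain q1 q2 where q: "\<forall>z. em_T z u r j (Suc k) = poly q1 z"
    "\<forall>z. em_T z u r (j - 1) (Suc k) = poly q2 z"
    using ge2.IH(2) by blast
  define d :: complex where "d = (of_nat j)\<^sup>2 / (of_nat j - of_nat (k + 1))\<^sup>2 - 1"
  show ?case
    by (rule exI[of _ "q1 + smult (inverse d) (q1 - q2)"])
      (use q in \<open>simp add: d_def divide_inverse mult.commute\<close>)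
qed

theorem em_Q_poly: "\<exists>q. \<forall>z. em_Q p m l z = poly q z"
  unfolding em_Q_def em_step_def by (rule em_T_poly)

end

theory Submission imports Defs begin

text \<open>
  Write \<open>p = 2 r\<close>. The tableau is the Aitken--Neville scheme in the variable \<open>1 / m\<^sup>2\<close>, so that
  \<open>em_Q p m l z\<close> is the product of a Lagrange weight, of modulus
  \<open>2 m\<^sup>2\<^sup>r / ((r - m)! (r + m)!)\<close>, and of the response of the midpoint recursion to a unit
  residual (\<open>em_T_single_entry\<close>, \<open>abs_extrapolation_weight\<close>). The proof bounds the three
  quantities that enter.

  \<^item> The points of the stability region have modulus at most \<open>p + 2\<close>
    (\<open>stab_region_norm_le\<close>), by an argument of Enestroem--Kakeya type.
  \<^item> The recursion grows by at most a factor \<open>y \<ge> 1\<close> per step whenever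
    \<open>y - 1 / y \<ge> \<bar>z\<bar> / m\<close> (\<open>em_Y_unit_norm_le\<close>). With \<open>y = exp s\<close> the condition is
    \<open>2 sinh s \<ge> \<bar>z\<bar> / m\<close>.
  \<^item> The weight is a binomial coefficient times \<open>2 m\<^sup>p / p!\<close>, and the binomial theorem and the
    exponential series bound these two factors (\<open>extrapolation_weight_le\<close>).

  Put \<open>\<mu> = m / r\<close>. Up to a constant factor, the best choice of the parameters in these estimates
  bounds the product by \<open>exp (p f(\<mu>))\<close>, where
  \<open>f(\<mu>) = ln \<mu> + 1 - ((1 - \<mu>) ln (1 - \<mu>) + (1 + \<mu>) ln (1 + \<mu>)) / 2 + \<mu> arsinh (1 / \<mu>)\<close>.
  All three summands of \<open>f\<close> that are not constant are concave, and the maximum of \<open>f\<close> is about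
  \<open>1.26364\<close>, attained near \<open>\<mu> = 0.8775\<close>, with \<open>exp 1.26364 \<approx> 3.5383\<close>. Each summand is replaced
  by a tangent line at a nearby point. The points are chosen so that all numbers stay rational
  or are exponentials of rationals, and so that the three slopes almost cancel; the resulting
  linear function of \<open>\<mu>\<close> then stays below \<open>ln 3.539\<close> at both ends of \<open>[0, 1]\<close>
  (\<open>growth_base_le\<close>), hence on all of it.

  This yields \<open>18 * 3.539\<^sup>p\<close> as a bound for every positive even \<open>p\<close> (\<open>em_M_stab_region_le\<close>). The
  constant and the denominator \<open>\<pi> \<surd>(p - 1)\<close> grow slower than \<open>((3.539 + \<epsilon>) / 3.539)\<^sup>p\<close>.
\<close>

section \<open>The stability region\<close>

lemma exp_partial_sum_telescope:
  fixes z :: "'a::{real_normed_field}"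
  shows "(\<Sum>k\<le>n. (z - of_nat k) * (z ^ k / fact k)) = z ^ Suc n / fact n"
proof (induction n)
  case 0
  show ?case by simp
next
  case (Suc n)
  have "z ^ Suc n / fact n = of_nat (Suc n) * (z ^ Suc n / fact (Suc n))"
    by (simp del: of_nat_Suc)
  then show ?case
    unfolding sum.atMost_Suc Suc.IH
    by (simp only: distrib_right[symmetric]) simp
qed

text \<open>
  The coefficients \<open>1 / k!\<close> satisfy \<open>1 / (k - 1)! \<le> n / k!\<close> for \<open>k \<le> n\<close>. Multiplying the partial
  sum by \<open>z - n\<close> therefore produces a polynomial whose coefficients below the leading one are all
  \<open>\<le> 0\<close>. The triangle inequality for such a polynomial is an equality at \<open>\<bar>z\<bar>\<close>, which gives back
  the same product with \<open>\<bar>z\<bar>\<close> in place of \<open>z\<close>.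
\<close>

lemma norm_exp_partial_sum_ge:
  fixes z :: complex
  shows "(cmod z - real n) * (\<Sum>k\<le>n. cmod z ^ k / fact k)
    \<le> (cmod z + real n) * cmod (\<Sum>k\<le>n. z ^ k / fact k)"
proof -
  have split: "(x - of_nat n) * (\<Sum>k\<le>n. x ^ k / fact k) =
      x ^ Suc n / fact n - (\<Sum>k\<le>n. of_nat (n - k) * (x ^ k / fact k))"
    for x :: "'a::{real_normed_field}"
  proof -
    have "(x - of_nat n) * (\<Sum>k\<le>n. x ^ k / fact k) =
        (\<Sum>k\<le>n. (x - of_nat k) * (x ^ k / fact k) - of_nat (n - k) * (x ^ k / fact k))"
      by (auto simp: sum_distrib_left of_nat_diff algebra_simps diff_divide_distrib
          add_divide_distrib intro!: sum.cong)
    then show ?thesis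
      by (simp only: sum_subtractf exp_partial_sum_telescope)
  qed
  have "cmod (\<Sum>k\<le>n. of_nat (n - k) * (z ^ k / fact k))
      \<le> (\<Sum>k\<le>n. of_nat (n - k) * (cmod z ^ k / fact k))"
    by (rule sum_norm_le) (simp add: norm_mult norm_divide norm_power del: of_nat_diff)
  then have "(cmod z - real n) * (\<Sum>k\<le>n. cmod z ^ k / fact k)
      \<le> cmod (z ^ Suc n / fact n) - cmod (\<Sum>k\<le>n. of_nat (n - k) * (z ^ k / fact k))"
    by (simp add: split norm_divide norm_power norm_mult)
  also have "\<dots> \<le> cmod ((z - of_nat n) * (\<Sum>k\<le>n. z ^ k / fact k))"
    unfolding split by (rule norm_triangle_ineq2)
  also have "\<dots> \<le> (cmod z + real n) * cmod (\<Sum>k\<le>n. z ^ k / fact k)"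
    unfolding norm_mult
    by (rule mult_right_mono) (use norm_triangle_ineq4[of z "of_nat n"] in auto)
  finally show ?thesis .
qed

text \<open>
  If \<open>\<bar>z\<bar> > p + 2\<close>, the partial sum at \<open>\<bar>z\<bar>\<close> is at least \<open>1 + \<bar>z\<bar>\<close>, and the previous inequality
  turns this into a partial sum at \<open>z\<close> of modulus above 1.
\<close>

lemma stab_region_norm_le:
  assumes "z \<in> stab_region p" "p \<ge> 1"
  shows "cmod z \<le> real p + 2"
proof (rule ccontr)
  assume "\<not> cmod z \<le> real p + 2"
  then have big: "cmod z - real p > 2" by simp
  have "1 + cmod z = (\<Sum>k\<le>1. cmod z ^ k / fact k)" by simp
  also have "\<dots> \<le> (\<Sum>k\<le>p. cmod z ^ k / fact k)"
    by (rule sum_mono2) (use assms(2) in auto)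
  finally have "2 * (1 + cmod z) \<le> (cmod z - real p) * (\<Sum>k\<le>p. cmod z ^ k / fact k)"
    using big by (intro mult_mono) auto
  also have "\<dots> \<le> (cmod z + real p) * cmod (\<Sum>k\<le>p. z ^ k / fact k)"
    by (rule norm_exp_partial_sum_ge)
  also have "\<dots> \<le> cmod z + real p"
    using assms(1) by (intro mult_left_le) (auto simp: stab_region_def)
  finally show False using big by simp
qed

section \<open>Growth of the midpoint recursion\<close>

lemma em_Y_zero:
  assumes "\<And>l. 1 \<le> l \<Longrightarrow> l \<le> j \<Longrightarrow> r m l = 0"
  shows "em_Y z 0 r m j = 0"
  using assms by (induction j rule: induct_nat_012) simp_all

text \<open>
  The hypothesis makes \<open>y ^ j\<close> a supersolution of \<open>x j = x (j - 2) + (\<bar>z\<bar> / m) x (j - 1)\<close>. Since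
  everything vanishes before step \<open>l\<close> and \<open>y \<ge> 1\<close>, the unit residual entering at step \<open>l\<close> lies
  below \<open>y ^ l\<close>.
\<close>

lemma em_Y_unit_norm_le:
  fixes y :: real
  assumes "y \<ge> 1" "y * (cmod z / real m) + 1 \<le> y\<^sup>2" "l \<ge> 1"
  shows "cmod (em_Y z 0 (\<lambda>m' l'. if m' = m \<and> l' = l then 1 else 0) m j)
    \<le> (if j < l then 0 else y ^ j)"
    (is "cmod (?Y j) \<le> _")
proof (induction j rule: induct_nat_012)
  case 0
  then show ?case using assms by simp
next
  case 1
  then show ?case using assms by auto
next
  case (ge2 j)
  show ?case
  proof (cases "Suc (Suc j) \<le> l")
    case True
    then have "?Y j = 0" "?Y (Suc j) = 0" using ge2 by auto
    then show ?thesis using True assms(1) by auto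
  next
    case False
    have "cmod (?Y (Suc (Suc j))) = cmod (?Y j + z / of_nat m * ?Y (Suc j))"
      using False by simp
    also have "\<dots> \<le> cmod (?Y j) + cmod z / real m * cmod (?Y (Suc j))"
      by (rule norm_triangle_le) (simp add: norm_mult norm_divide)
    also have "\<dots> \<le> y ^ j + cmod z / real m * y ^ Suc j"
    proof (intro add_mono mult_left_mono)
      show "cmod (?Y j) \<le> y ^ j" "cmod (?Y (Suc j)) \<le> y ^ Suc j"
        using ge2 assms(1) by (auto split: if_splits intro: order_trans)
    qed simp
    also have "\<dots> = y ^ j * (y * (cmod z / real m) + 1)" by (simp add: algebra_simps)
    also have "\<dots> \<le> y ^ j * y\<^sup>2" using assms by (intro mult_left_mono) auto
    finally show ?thesis using False by (simp add: power2_eq_square algebra_simps)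
  qed
qed

section \<open>The extrapolation weights\<close>

text \<open>
  The value at 0 of the Lagrange basis polynomial that belongs to the node \<open>1 / m\<^sup>2\<close> among the
  nodes \<open>1 / i\<^sup>2\<close>, \<open>i \<in> A\<close>.
\<close>

definition extrapolation_weight :: "nat set \<Rightarrow> nat \<Rightarrow> real" where
  "extrapolation_weight A m = (\<Prod>i\<in>A - {m}. (real m)\<^sup>2 / ((real m)\<^sup>2 - (real i)\<^sup>2))"

text \<open>
  The closed form of the Aitken--Neville scheme, for a first column with at most one nonzero entry
  \<open>m\<close>: column \<open>k\<close> of row \<open>j\<close> extrapolates from the window of rows \<open>j - k + 1, \<dots>, j\<close>. The induction
  step merges the windows \<open>{b + 1..j}\<close> and \<open>{b..j - 1}\<close> into \<open>{b..j}\<close>; the row \<open>m\<close> may lie in both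
  windows, only in the first (\<open>m = j\<close>), only in the second (\<open>m = b\<close>), or in neither.
\<close>

lemma em_T_single_entry:
  assumes "\<And>i. i \<noteq> m \<Longrightarrow> em_Y z u r i (2 * i) = 0" "1 \<le> k" "k \<le> j"
  shows "em_T z u r j k = (if m \<in> {Suc (j - k)..j}
    then of_real (extrapolation_weight {Suc (j - k)..j} m) * em_Y z u r m (2 * m) else 0)"
  using assms(2,3)
proof (induction k arbitrary: j rule: induct_nat_012)
  case 0
  then show ?case by simp
next
  case 1
  then have "{Suc (j - Suc 0)..j} = {j}" by auto
  then show ?case using assms(1)[of j] by (auto simp: extrapolation_weight_def)
next
  case (ge2 k)
  define b where "b = j - Suc k"
  define Y where "Y = em_Y z u r m (2 * m)"
  define W :: "nat set \<Rightarrow> complex"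
    where "W A = (if m \<in> A then of_real (extrapolation_weight A m) else 0)" for A
  have b: "1 \<le> b" "b < j" "of_nat j - of_nat (k + 1) = (of_nat b :: complex)"
    using ge2.prems by (auto simp: b_def of_nat_diff)
  have IH: "em_T z u r j (Suc k) = W {Suc b..j} * Y"
    "em_T z u r (j - 1) (Suc k) = W {b..j - 1} * Y"
  proof -
    show "em_T z u r j (Suc k) = W {Suc b..j} * Y"
      using ge2.IH(2)[of j] ge2.prems by (auto simp: b_def W_def Y_def)
    have "Suc (j - 1 - Suc k) = b" using ge2.prems by (simp add: b_def)
    then show "em_T z u r (j - 1) (Suc k) = W {b..j - 1} * Y"
      using ge2.IH(2)[of "j - 1"] ge2.prems by (auto simp: W_def Y_def)
  qed
  have goal: "Suc (j - Suc (Suc k)) = b" using ge2.prems by (simp add: b_def)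
  have W0: "extrapolation_weight (insert i A) m =
      (real m)\<^sup>2 / ((real m)\<^sup>2 - (real i)\<^sup>2) * extrapolation_weight A m"
    if "i \<noteq> m" "i \<notin> A" "finite A" for i A
    using that by (simp add: extrapolation_weight_def insert_Diff_if)
  have W1: "extrapolation_weight (insert m A) m = extrapolation_weight A m" for A
    by (simp add: extrapolation_weight_def insert_Diff_if)
  have sq: "(complex_of_nat a)\<^sup>2 \<noteq> (complex_of_nat c)\<^sup>2" if "a \<noteq> c" for a c
    using that by (metis of_nat_eq_iff of_nat_power power2_eq_iff_nonneg zero_le)
  define A where "A = {Suc b..j - 1}"
  have sets: "{Suc b..j} = insert j A" "{b..j - 1} = insert b A" "{b..j} = insert b (insert j A)"
    and notin: "j \<notin> A" "b \<notin> A" "b \<noteq> j" "finite A"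
    using b by (auto simp: A_def)
  have "W {Suc b..j} + (W {Suc b..j} - W {b..j - 1}) / ((of_nat j)\<^sup>2 / (of_nat b)\<^sup>2 - 1)
      = W {b..j}"
  proof -
    let ?J = "(complex_of_nat j)\<^sup>2" and ?B = "(complex_of_nat b)\<^sup>2" and ?M = "(complex_of_nat m)\<^sup>2"
    have nz: "?B \<noteq> 0" "?J - ?B \<noteq> 0" using b(1) sq[of j b] notin by auto
    \<comment> \<open>The recursion of the tableau, written as a step of Neville's algorithm.\<close>
    have comb: "x + (x - y) / (?J / ?B - 1) = (?J * x - ?B * y) / (?J - ?B)" for x y
    proof -
      have "?J / ?B - 1 = (?J - ?B) / ?B" using nz by (simp add: field_simps)
      then show ?thesis using nz by (simp add: field_simps)
    qed
    show ?thesis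
      unfolding comb
    proof (cases "m \<in> A")
      case True
      then have ne: "m \<noteq> j" "m \<noteq> b" using notin by auto
      define w where "w = complex_of_real (extrapolation_weight A m)"
      have nz': "?M - ?J \<noteq> 0" "?M - ?B \<noteq> 0" using sq ne by auto
      have 1: "W {Suc b..j} = ?M / (?M - ?J) * w" "W {b..j - 1} = ?M / (?M - ?B) * w"
        "W {b..j} = ?M / (?M - ?B) * (?M / (?M - ?J) * w)"
        using True ne notin unfolding W_def sets w_def by (auto simp: W0)
      have "?J * (?M / (?M - ?J)) - ?B * (?M / (?M - ?B)) =
          (?M / (?M - ?B)) * (?M / (?M - ?J)) * (?J - ?B)"
        using nz' by (simp add: field_simps)
      moreover have "?J * W {Suc b..j} - ?B * W {b..j - 1} =
          (?J * (?M / (?M - ?J)) - ?B * (?M / (?M - ?B))) * w"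
        unfolding 1 by (simp only: left_diff_distrib mult.assoc)
      ultimately have "?J * W {Suc b..j} - ?B * W {b..j - 1} = W {b..j} * (?J - ?B)"
        unfolding 1 by (simp only: mult_ac)
      then show "(?J * W {Suc b..j} - ?B * W {b..j - 1}) / (?J - ?B) = W {b..j}"
        using nz by (simp add: field_simps)
    next
      case False
      consider "m = j" | "m = b" | "m \<noteq> j" "m \<noteq> b" by blast
      then show "(?J * W {Suc b..j} - ?B * W {b..j - 1}) / (?J - ?B) = W {b..j}"
      proof cases
        case 1
        then have "extrapolation_weight (insert b (insert j A)) m =
            (real m)\<^sup>2 / ((real m)\<^sup>2 - (real b)\<^sup>2) * extrapolation_weight A m"
          using W0[of b "insert j A"] W1[of A] notin by simp
        then have "W {Suc b..j} = of_real (extrapolation_weight A m)" "W {b..j - 1} = 0"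
          "W {b..j} = ?J / (?J - ?B) * of_real (extrapolation_weight A m)"
          using notin 1 W1[of A] unfolding W_def sets by simp_all
        then show ?thesis by simp
      next
        case 2
        then have "extrapolation_weight (insert b (insert j A)) m =
            (real m)\<^sup>2 / ((real m)\<^sup>2 - (real j)\<^sup>2) * extrapolation_weight A m"
          using W0[of j A] W1[of "insert j A"] notin by simp
        then have "W {b..j - 1} = of_real (extrapolation_weight A m)" "W {Suc b..j} = 0"
          "W {b..j} = ?B / (?B - ?J) * of_real (extrapolation_weight A m)"
          using notin 2 W1[of A] unfolding W_def sets by simp_all
        then show ?thesis using nz sq[of b j] notin by (simp add: field_simps)
      next
        case 3
        then show ?thesis using False unfolding W_def sets by auto
      qed
    qed
  qed
  then have "em_T z u r j (Suc (Suc k)) = W {b..j} * Y"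
    unfolding em_T.simps(3) IH b(3)
    by (simp only: flip: left_diff_distrib distrib_right times_divide_eq_left)
  then show ?case unfolding goal by (simp add: W_def Y_def)
qed

text \<open>
  Induction on \<open>r \<ge> m\<close> multiplies the product by the factor of the new row. The base case \<open>r = m\<close>
  needs the partial products over the rows \<open>1, \<dots>, k\<close> with \<open>k < m\<close>, which have an explicit form of
  their own.
\<close>

lemma abs_extrapolation_weight:
  assumes "1 \<le> m" "m \<le> r"
  shows "\<bar>extrapolation_weight {1..r} m\<bar> = 2 * real m ^ (2 * r) / (fact (r - m) * fact (r + m))"
  using assms(2)
proof (induction r rule: dec_induct)
  case base
  have part: "\<bar>extrapolation_weight {1..k} m\<bar> =
      real m ^ (2 * k) * fact (m - Suc k) * fact m / (fact (m - 1) * fact (m + k))"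
    if "k < m" for k
    using that
  proof (induction k)
    case 0
    then show ?case by (simp add: extrapolation_weight_def)
  next
    case (Suc k)
    define d where "d = m - Suc (Suc k)"
    have d: "m - Suc k = Suc d" "real m = real d + real k + 2" using Suc.prems by (auto simp: d_def)
    have "{1..Suc k} - {m} = insert (Suc k) ({1..k} - {m})" using Suc.prems by auto
    then have "\<bar>extrapolation_weight {1..Suc k} m\<bar> =
        (real m)\<^sup>2 / \<bar>(real m)\<^sup>2 - (real (Suc k))\<^sup>2\<bar> * \<bar>extrapolation_weight {1..k} m\<bar>"
      by (simp add: extrapolation_weight_def abs_mult)
    moreover have "\<bar>(real m)\<^sup>2 - (real (Suc k))\<^sup>2\<bar> = real (Suc d) * real (m + Suc k)"
      by (simp add: d power2_eq_square algebra_simps)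
    ultimately have "\<bar>extrapolation_weight {1..Suc k} m\<bar> =
        (real m)\<^sup>2 / (real (Suc d) * real (m + Suc k)) *
        (real m ^ (2 * k) * (real (Suc d) * fact d) * fact m / (fact (m - 1) * fact (m + k)))"
      using Suc by (simp add: d)
    also have "\<dots> = (real (Suc d) / real (Suc d)) * ((real m)\<^sup>2 * real m ^ (2 * k) * fact d * fact m /
        (fact (m - 1) * (real (m + Suc k) * fact (m + k))))"
      by (simp only: times_divide_times_eq times_divide_eq_left times_divide_eq_right
          divide_divide_eq_left mult_ac)
    also have "\<dots> = real m ^ (2 * Suc k) * fact d * fact m / (fact (m - 1) * fact (m + Suc k))"
      by (simp add: power2_eq_square mult_ac)
    finally show ?case by (simp only: d_def)
  qed
  obtain n where n: "m = Suc n" using assms(1) by (cases m) auto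
  have "{1..m} - {m} = {1..n} - {m}" using n by auto
  then have "\<bar>extrapolation_weight {1..m} m\<bar> =
      real m ^ (2 * n) * fact 0 * fact m / (fact n * fact (m + n))"
    using part[of n] n by (simp add: extrapolation_weight_def)
  also have "\<dots> = real m ^ (2 * n) * real m / fact (m + n)"
    by (simp add: n del: of_nat_Suc)
  also have "\<dots> = 2 * real m ^ (2 * m) / fact (m + m)"
  proof -
    have "fact (m + m) = 2 * real m * (fact (m + n) :: real)" by (simp add: n)
    moreover have "real m ^ (2 * m) = real m ^ (2 * n) * real m * real m" by (simp add: n)
    ultimately show ?thesis using assms(1) by simp
  qed
  finally show ?case by simp
next
  case (step r)
  have "{1..Suc r} - {m} = insert (Suc r) ({1..r} - {m})" using step assms by auto
  then have "\<bar>extrapolation_weight {1..Suc r} m\<bar> =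
      (real m)\<^sup>2 / \<bar>(real m)\<^sup>2 - (real (Suc r))\<^sup>2\<bar> * \<bar>extrapolation_weight {1..r} m\<bar>"
    by (simp add: extrapolation_weight_def abs_mult)
  moreover obtain d where d: "r = m + d" using step by (metis le_Suc_ex)
  moreover have "\<bar>(real m)\<^sup>2 - (real (Suc r))\<^sup>2\<bar> = real (Suc d) * real (Suc (r + m))"
  proof -
    have "(real m)\<^sup>2 - (real (Suc r))\<^sup>2 = - (real (Suc d) * real (Suc (r + m)))"
      by (simp add: d power2_eq_square algebra_simps)
    then show ?thesis by (simp only: abs_minus_cancel abs_mult abs_of_nat)
  qed
  ultimately show ?case using step.IH
    by (simp add: power2_eq_square Suc_diff_le mult_ac)
qed

lemma power_le_exp_fact:
  fixes x :: real
  assumes "x \<ge> 0"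
  shows "x ^ n \<le> exp x * fact n"
proof -
  have "x ^ n /\<^sub>R fact n \<le> exp x"
    using sum_le_suminf[OF summable_exp_generic[of x], of "{n}"] assms by (simp add: exp_def)
  then show ?thesis by (simp add: field_simps)
qed

text \<open>
  The weight is \<open>2 m\<^sup>2\<^sup>r / (2 r)!\<close> times the binomial coefficient of \<open>2 r\<close> over \<open>r - m\<close>. A single
  term of the binomial expansion of \<open>(1 + v\<^sup>2)\<^sup>2\<^sup>r\<close> bounds the latter, and a single term of the series
  of \<open>exp (2 r)\<close> bounds \<open>1 / (2 r)!\<close>. The parameter \<open>v\<close> is free; the best value is
  \<open>v\<^sup>2 = (r - m) / (r + m)\<close>, but any value independent of \<open>m\<close> makes the
  bound geometric in \<open>m\<close>, apart from the factor \<open>(m / r)\<^sup>2\<^sup>r\<close>.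
\<close>

lemma extrapolation_weight_le:
  fixes v :: real
  assumes "1 \<le> m" "m \<le> r" "v > 0"
  shows "\<bar>extrapolation_weight {1..r} m\<bar>
    \<le> 2 * (real m / real r * (exp 1 / 2) * ((1 + v\<^sup>2) / v)) ^ (2 * r) * v ^ (2 * m)"
proof -
  have r: "r > 0" using assms by simp
  have "real (2 * r choose (r - m)) * (v\<^sup>2) ^ (r - m) \<le>
      (\<Sum>k\<le>2 * r. real (2 * r choose k) * (v\<^sup>2) ^ k * 1 ^ (2 * r - k))"
    by (rule order_trans[OF _ member_le_sum[of "r - m"]]) (use assms in auto)
  also have "\<dots> = (v\<^sup>2 + 1) ^ (2 * r)" by (rule binomial_ring[symmetric])
  finally have "real (2 * r choose (r - m)) * (v\<^sup>2) ^ (r - m) * v ^ (2 * m)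
      \<le> (1 + v\<^sup>2) ^ (2 * r) * v ^ (2 * m)"
    using assms by (intro mult_right_mono) (auto simp: add.commute)
  moreover have "(v\<^sup>2) ^ (r - m) * v ^ (2 * m) = v ^ (2 * r)"
    using assms by (simp add: right_diff_distrib' flip: power_mult power_add)
  ultimately have "real (2 * r choose (r - m)) * v ^ (2 * r) \<le> (1 + v\<^sup>2) ^ (2 * r) * v ^ (2 * m)"
    by (simp add: mult.assoc)
  then have choose: "real (2 * r choose (r - m)) \<le> ((1 + v\<^sup>2) / v) ^ (2 * r) * v ^ (2 * m)"
    using assms(3) by (simp add: power_divide field_simps)
  have fact_ge: "1 / fact (2 * r) \<le> (exp 1 / (2 * real r)) ^ (2 * r)"
    using power_le_exp_fact[of "real (2 * r)" "2 * r"] r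
    by (simp add: power_divide field_simps flip: exp_of_nat_mult)
  have "real (2 * r choose (r - m)) = fact (2 * r) / (fact (r - m) * fact (r + m))"
    using binomial_fact[of "r - m" "2 * r", where ?'a = real] assms by (simp add: mult_2)
  then have "\<bar>extrapolation_weight {1..r} m\<bar> =
      2 * real m ^ (2 * r) * (1 / fact (2 * r)) * real (2 * r choose (r - m))"
    using abs_extrapolation_weight[OF assms(1,2)] by simp
  also have "\<dots> \<le> 2 * real m ^ (2 * r) * (exp 1 / (2 * real r)) ^ (2 * r) *
      (((1 + v\<^sup>2) / v) ^ (2 * r) * v ^ (2 * m))"
    using fact_ge choose by (intro mult_mono) auto
  also have "\<dots> = 2 * (real m / real r * (exp 1 / 2) * ((1 + v\<^sup>2) / v)) ^ (2 * r) * v ^ (2 * m)"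
    by (simp add: power_mult_distrib power_divide mult_ac)
  finally show ?thesis .
qed


section \<open>The growth constant\<close>

lemma sinh_ge_tangent:
  fixes a s :: real
  assumes "a > 0" "s \<ge> 0"
  shows "sinh a + cosh a * (s - a) \<le> sinh s"
proof -
  have "convex_on {0::real..} sinh"
  proof (rule f''_ge0_imp_convex)
    show "(sinh has_real_derivative cosh x) (at x)" "(cosh has_real_derivative sinh x) (at x)"
      for x :: real
      by (auto intro!: derivative_eq_intros)
  qed auto
  then have "cosh a * (s - a) \<le> sinh s - sinh a"
    by (rule convex_on_imp_above_tangent)
      (use assms in \<open>auto intro!: derivative_eq_intros connected_Ici simp: interior_Ici[of _ "-1"]\<close>)
  then show ?thesis by simp
qed

text \<open>The remainder of the Taylor formula, with \<open>exp 2 \<le> 9\<close>.\<close>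

lemma exp_le_Taylor:
  fixes x :: real
  assumes "0 \<le> x" "x \<le> 2"
  shows "exp x \<le> (\<Sum>k<n. x ^ k / fact k) + 9 / fact n * x ^ n"
proof -
  obtain t where t: "\<bar>t\<bar> \<le> \<bar>x\<bar>" "exp x = (\<Sum>k<n. x ^ k / fact k) + exp t / fact n * x ^ n"
    using Maclaurin_exp_le by blast
  have "exp t \<le> exp (2 * 1)" using t(1) assms by simp
  also have "\<dots> = (exp 1)\<^sup>2" by (rule exp_double)
  also have "\<dots> \<le> 3\<^sup>2" by (rule power_mono[OF exp_le]) simp
  finally have "exp t / fact n * x ^ n \<le> 9 / fact n * x ^ n"
    using assms by (intro mult_right_mono divide_right_mono) auto
  then show ?thesis using t(2) by simp
qed

text \<open>
  Here \<open>v\<close> is the parameter of \<open>extrapolation_weight_le\<close>. The number \<open>a\<close> is the value at \<open>\<mu> = 0\<close> of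
  the exponential of the linear bound for \<open>f\<close>, and the second factor in the second inequality is the
  exponential of its slope. The logarithm is bounded by its tangent at \<open>\<mu> = 8 / 9\<close>, which yields
  \<open>4 / 9 = (8 / 9) / 2\<close> and \<open>9 / 8\<close>; the function \<open>arsinh\<close> is bounded by its tangent at
  \<open>55 / 48 = sinh (ln (8 / 3))\<close>, where the slope is \<open>48 / 73 = 1 / cosh (ln (8 / 3))\<close>. The best \<open>v\<close> at
  \<open>\<mu> = 0.8775\<close> is about \<open>0.2555\<close>. The nearby value \<open>15 / 58\<close> compensates the slopes of these two
  tangents: both left-hand sides lie between \<open>3.538\<close> and \<open>3.539\<close>.
\<close>

lemma growth_base_le:
  defines "v \<equiv> 15 / 58 :: real"
  defines "a \<equiv> 4 / 9 * ((1 + v\<^sup>2) / v) * exp (48 / 73)"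
  shows "a \<le> 3.539" "a * (v * (8 / 3) * exp (9 / 8 - 55 / 73)) \<le> 3.539"
proof -
  have "exp (48 / 73 :: real) \<le> 1.9301"
    by (rule order_trans[OF exp_le_Taylor[of _ 10]])
      (simp_all add: eval_nat_numeral field_simps)
  then show "a \<le> 3.539" by (simp add: a_def v_def power2_eq_square)
  have "exp (601 / 584 :: real) \<le> 2.79865"
    by (rule order_trans[OF exp_le_Taylor[of _ 12]])
      (simp_all add: eval_nat_numeral field_simps)
  moreover have "exp (48 / 73) * exp (9 / 8 - 55 / 73) = exp (601 / 584 :: real)"
    by (simp flip: exp_add)
  moreover have "a * (v * (8 / 3) * exp (9 / 8 - 55 / 73)) =
      4 / 9 * (1 + v\<^sup>2) * (8 / 3) * (exp (48 / 73) * exp (9 / 8 - 55 / 73))"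
    by (simp add: a_def v_def)
  ultimately show "a * (v * (8 / 3) * exp (9 / 8 - 55 / 73)) \<le> 3.539"
    by (simp add: v_def power2_eq_square)
qed

text \<open>
  The quantity \<open>s\<close> is the tangent of \<open>arsinh\<close> at \<open>55 / 48\<close>, evaluated at \<open>t = (r + 1) / m\<close>, the
  largest value of \<open>\<bar>z\<bar> / (2 m)\<close> for \<open>\<bar>z\<bar> \<le> p + 2\<close>. In \<open>2 m s\<close> the excess of \<open>t\<close> over \<open>r / m\<close>
  contributes only the constant \<open>2 * 48 / 73\<close>, which is why the final factor does not depend on
  \<open>r\<close>. What remains is a product \<open>a\<^sup>2\<^sup>r b\<^sup>2\<^sup>m\<close>, which lies between its values at \<open>m = 0\<close> and
  \<open>m = r\<close>.
\<close>

lemma weight_times_growth_le: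
  fixes s :: real
  assumes "1 \<le> m" "m \<le> r"
  defines "s \<equiv> ln (8 / 3) + (48 * ((real r + 1) / real m) - 55) / 73"
  shows "\<bar>extrapolation_weight {1..r} m\<bar> * exp s ^ (2 * m) \<le> 18 * 3.539 ^ (2 * r)"
proof -
  define v :: real where "v = 15 / 58"
  define \<mu> where "\<mu> = real m / real r"
  define a where "a = 4 / 9 * ((1 + v\<^sup>2) / v) * exp (48 / 73)"
  define b where "b = v * (8 / 3) * exp (9 / 8 - 55 / 73)"
  have pos: "v > 0" "\<mu> \<ge> 0" "a > 0" "b > 0"
    by (auto simp: v_def \<mu>_def a_def b_def intro!: mult_pos_pos divide_pos_pos add_pos_nonneg)
  have r: "real r > 0" "real m > 0" using assms by auto
  \<comment> \<open>The tangent of the logarithm at \<open>8 / 9\<close>.\<close>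
  have "\<mu> \<le> 8 / 9 * exp (9 / 8 * \<mu> - 1)"
    using exp_ge_add_one_self[of "9 / 8 * \<mu> - 1"] by simp
  then have "(\<mu> * (exp 1 / 2) * ((1 + v\<^sup>2) / v)) ^ (2 * r) \<le>
      (8 / 9 * exp (9 / 8 * \<mu> - 1) * (exp 1 / 2) * ((1 + v\<^sup>2) / v)) ^ (2 * r)"
    using pos by (intro power_mono mult_right_mono) auto
  also have "8 / 9 * exp (9 / 8 * \<mu> - 1) * (exp 1 / 2) * ((1 + v\<^sup>2) / v) =
      4 / 9 * ((1 + v\<^sup>2) / v) * exp (9 / 8 * \<mu>)"
    by (simp add: exp_diff)
  also have "\<dots> ^ (2 * r) = (4 / 9 * ((1 + v\<^sup>2) / v)) ^ (2 * r) * exp (9 / 8) ^ (2 * m)"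
  proof -
    have "exp (9 / 8 * \<mu>) ^ (2 * r) = exp (9 / 8) ^ (2 * m)"
      using r by (simp add: \<mu>_def flip: exp_of_nat_mult)
    then show ?thesis by (simp only: power_mult_distrib)
  qed
  finally have w: "\<bar>extrapolation_weight {1..r} m\<bar> \<le>
      2 * ((4 / 9 * ((1 + v\<^sup>2) / v)) ^ (2 * r) * exp (9 / 8) ^ (2 * m)) * v ^ (2 * m)"
    using extrapolation_weight_le[OF assms(1,2) pos(1)] pos unfolding \<mu>_def
    by (elim order_trans) (intro mult_right_mono mult_left_mono, auto)
  have "real (2 * m) * s =
      real (2 * m) * (ln (8 / 3) - 55 / 73) + real (2 * r) * (48 / 73) + 96 / 73"
    using r by (simp add: s_def field_simps)
  then have "exp (real (2 * m) * s) =
      exp (ln (8 / 3) - 55 / 73) ^ (2 * m) * exp (48 / 73) ^ (2 * r) * exp (96 / 73)"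
    by (simp only: exp_add exp_of_nat_mult)
  moreover have "exp (ln (8 / 3) - 55 / 73 :: real) = 8 / 3 * exp (- (55 / 73))"
    using exp_add[of "ln (8 / 3)" "- (55 / 73) :: real"] by simp
  ultimately have "exp s ^ (2 * m) =
      ((8 / 3) * exp (- (55 / 73))) ^ (2 * m) * exp (48 / 73) ^ (2 * r) * exp (96 / 73)"
    by (simp only: exp_of_nat_mult)
  with w have "\<bar>extrapolation_weight {1..r} m\<bar> * exp s ^ (2 * m) \<le>
      2 * ((4 / 9 * ((1 + v\<^sup>2) / v)) ^ (2 * r) * exp (9 / 8) ^ (2 * m)) * v ^ (2 * m) *
      (((8 / 3) * exp (- (55 / 73))) ^ (2 * m) * exp (48 / 73) ^ (2 * r) * exp (96 / 73))"
    by (auto intro!: mult_right_mono)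
  also have "\<dots> = 2 * exp (96 / 73) * (a ^ (2 * r) * b ^ (2 * m))"
  proof -
    have "exp (9 / 8 - 55 / 73 :: real) = exp (9 / 8) * exp (- (55 / 73))"
      by (simp flip: exp_add)
    then show ?thesis unfolding a_def b_def by (simp only: power_mult_distrib mult_ac)
  qed
  also have "a ^ (2 * r) * b ^ (2 * m) = a ^ (2 * (r - m)) * (a * b) ^ (2 * m)"
    using assms(2) by (simp add: power_mult_distrib right_diff_distrib' flip: power_add mult.assoc)
  also have "\<dots> \<le> 3.539 ^ (2 * (r - m)) * 3.539 ^ (2 * m)"
    using growth_base_le pos by (intro mult_mono power_mono) (auto simp: a_def b_def v_def)
  also have "\<dots> = 3.539 ^ (2 * r)"
    using assms(2) by (simp add: right_diff_distrib' flip: power_add)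
  also have "2 * exp (96 / 73 :: real) \<le> 18"
  proof -
    have "exp (96 / 73 :: real) \<le> 9"
      by (rule order_trans[OF exp_le_Taylor[of _ 3]]) (simp_all add: eval_nat_numeral)
    then show ?thesis by simp
  qed
  finally show ?thesis by (simp add: mult_left_mono mult_right_mono)
qed

text \<open>
  Convexity of \<open>sinh\<close> shows that the tangent value \<open>s\<close> satisfies \<open>sinh s \<ge> t \<ge> \<bar>z\<bar> / (2 m)\<close>, so that
  \<open>exp s\<close> is an admissible growth factor of the recursion.
\<close>

lemma em_Q_norm_le:
  assumes "even p" "m \<in> {1..p div 2}" "l \<in> {1..2 * m}" "cmod z \<le> real p + 2"
  shows "cmod (em_Q p m l z) \<le> 18 * 3.539 ^ p"
proof -
  define r where "r = p div 2"
  have p: "p = 2 * r" using assms(1) by (simp add: r_def)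
  have m: "1 \<le> m" "m \<le> r" using assms(2) by (auto simp: r_def)
  define t where "t = (real r + 1) / real m"
  define s where "s = ln (8 / 3) + (48 * t - 55) / 73"
  let ?e = "\<lambda>m' l'. if m' = m \<and> l' = l then 1 else (0::complex)"
  have "t \<ge> 1" using m by (simp add: t_def)
  moreover have "ln (8 / 3 :: real) \<ge> 5 / 8"
    using ln_le_minus_one[of "3 / 8 :: real"] by (simp add: ln_div)
  ultimately have s: "s \<ge> 0" unfolding s_def by argo
  have growth: "exp s * (cmod z / real m) + 1 \<le> (exp s)\<^sup>2"
  proof -
    have "cmod z / real m \<le> 2 * t"
      using m assms(4) by (simp add: t_def p field_simps)
    also have "t = sinh (ln (8 / 3)) + cosh (ln (8 / 3)) * (s - ln (8 / 3))"
      by (simp add: s_def sinh_ln_real cosh_ln_real field_simps)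
    also have "2 * \<dots> \<le> 2 * sinh s"
      using sinh_ge_tangent[of "ln (8 / 3)" s] s by simp
    also have "\<dots> = exp s - exp (- s)" by (simp add: sinh_def)
    finally have "exp s * (cmod z / real m) \<le> exp s * (exp s - exp (- s))"
      by (intro mult_left_mono) auto
    also have "\<dots> = (exp s)\<^sup>2 - 1"
      by (simp add: right_diff_distrib power2_eq_square flip: exp_add)
    finally show ?thesis by simp
  qed
  have "cmod (em_Y z 0 ?e m (2 * m)) \<le> exp s ^ (2 * m)"
    using em_Y_unit_norm_le[OF _ growth, of l "2 * m"] s assms(3) by auto
  moreover have "em_Q p m l z =
      of_real (extrapolation_weight {1..r} m) * em_Y z 0 ?e m (2 * m)"
    using em_T_single_entry[of m z 0 ?e r r] m em_Y_zero
    by (auto simp: em_Q_def em_step_def r_def)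
  ultimately have "cmod (em_Q p m l z) \<le>
      \<bar>extrapolation_weight {1..r} m\<bar> * exp s ^ (2 * m)"
    by (auto simp: norm_mult intro: mult_left_mono)
  also have "\<dots> \<le> 18 * 3.539 ^ p"
    using weight_times_growth_le[OF m] by (simp only: s_def t_def p)
  finally show ?thesis .
qed

lemma em_M_stab_region_le:
  assumes "even p" "p \<ge> 2"
  shows "em_M p (stab_region p) \<le> ereal (18 * 3.539 ^ p)"
proof -
  have "(SUP z\<in>stab_region p. ereal (cmod (em_Q p m l z))) \<le> ereal (18 * 3.539 ^ p)"
    if "m \<in> {1..p div 2}" "l \<in> {1..2 * m}" for m l
    using that assms em_Q_norm_le stab_region_norm_le by (intro SUP_least) auto
  then show ?thesis
    unfolding em_M_def using assms(2) by (intro Max.boundedI) auto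
qed

theorem theorem4p22:
  fixes \<epsilon> :: real
  assumes "\<epsilon> > 0"
  shows "\<exists>p\<^sub>0 :: nat. p\<^sub>0 > 0 \<and> (\<forall>p \<ge> p\<^sub>0. even p \<longrightarrow>
    em_M p (stab_region p) < ereal ((3.539 + \<epsilon>) ^ p / (pi * sqrt (real p - 1))))"
proof -
  define c where "c = (3.539 + \<epsilon>) / 3.539"
  have "c > 1" using assms by (simp add: c_def)
  then have "(\<lambda>n. real n * (1 / c) ^ n) \<longlonglongrightarrow> 0"
    by (intro powser_times_n_limit_0) simp
  then have "eventually (\<lambda>n. real n * (1 / c) ^ n < 1 / (18 * pi)) sequentially"
    by (rule order_tendstoD) simp
  then obtain N where N: "real n * (1 / c) ^ n < 1 / (18 * pi)" if "n \<ge> N" for n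
    by (auto simp: eventually_sequentially)
  have subexp: "18 * (pi * sqrt (real n - 1)) < c ^ n" if "n \<ge> N + 2" for n
  proof -
    have "sqrt (real n - 1) \<le> real n"
      using that
      by (intro real_le_lsqrt) (auto simp: power2_eq_square intro: order_trans[of _ "real n * 1"])
    then have "18 * (pi * sqrt (real n - 1)) \<le> 18 * (pi * real n)" by simp
    also have "\<dots> < c ^ n" using N[of n] that \<open>c > 1\<close> by (simp add: power_divide field_simps)
    finally show ?thesis .
  qed
  show ?thesis
  proof (intro exI[of _ "N + 2"] conjI allI impI)
    fix p assume p: "p \<ge> N + 2" "even p"
    have "18 * (pi * sqrt (real p - 1)) * 3.539 ^ p < c ^ p * 3.539 ^ p"
      using subexp p by (intro mult_strict_right_mono) auto
    also have "\<dots> = (c * 3.539) ^ p" by (simp only: power_mult_distrib)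
    also have "c * 3.539 = 3.539 + \<epsilon>" by (simp add: c_def)
    finally have "18 * 3.539 ^ p < (3.539 + \<epsilon>) ^ p / (pi * sqrt (real p - 1))"
      using p by (subst pos_less_divide_eq) (auto simp: mult_ac)
    then show "em_M p (stab_region p) < ereal ((3.539 + \<epsilon>) ^ p / (pi * sqrt (real p - 1)))"
      using em_M_stab_region_le[of p] p
      by (intro le_less_trans[OF _ less_ereal.simps(1)[THEN iffD2]]) auto
  qed simp
qed

end
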